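(* Let $t \in \{1,2,3\}$ and let $G$ be a graph that is not (isomorphic to) a member of $\{K_1 \dot{\cup} P_3,\ K_2 \dot{\cup} 2K_1,\ 4K_1\}$. Then $\operatorname{th}_{\operatorname{Z}}(G)=t$ if and only if $\operatorname{th}_{\lfloor \operatorname{Z}\rfloor}(G)=t$.
   Context: All graphs are finite, simple, undirected. $K_n$ and $P_n$ are the complete graph and path on $n$ vertices; $\dot\cup$ denotes disjoint union of graphs and $mH$ is the disjoint union of $m$ copies of $H$. Color change rules: each vertex of $G$ is blue or white; a vertex is active if it is blue and has not yet performed a force. The standard ($\operatorname{Z}$) rule: a blue vertex $u$ can force a white vertex $w$ to become blue (written $u\to w$) if $w$ is the only white neighbor of $u$. The $\lfloor \operatorname{Z}\rfloor$ rule: either apply the standard rule, or, if $v$ is active and all neighbors of $v$ are blue, then $v$ can force any single white vertex $w$ of $G$ to become blue (a "hop"). Let $R\in\{\operatorname{Z},\lfloor \operatorname{Z}\rfloor\}$. For $B\subseteq V(G)$, color $B$ blue and $V(G)\setminus B$ white, and apply rule $R$ repeatedly, one force at a time, until no longer possible; the unordered set $\mathcal F$ of forces performed is called a set of $R$ forces of $B$ (it depends on choices). Put $\mathcal F^{(0)}=B$, and for $t\ge 0$ let $\mathcal F^{(t+1)}$ be the set of (white) vertices $w$ such that some force $v\to w$ is in $\mathcal F$ and $v$ can force $w$ by rule $R$ when exactly the vertices in $\bigcup_{i=0}^t\mathcal F^{(i)}$ are blue. The propagation time $\operatorname{pt}_{R}(G;\mathcal F)$ is the least $t'$ with $V(G)=\bigcup_{i=0}^{t'}\mathcal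 F^{(i)}$, and is $\infty$ if the forces in $\mathcal F$ do not color all of $V(G)$ blue. Define $\operatorname{pt}_{R}(G;B)$ as the minimum of $\operatorname{pt}_{R}(G;\mathcal F)$ over all sets $\mathcal F$ of $R$ forces of $B$, $\operatorname{th}_{R}(G;B)=|B|+\operatorname{pt}_{R}(G;B)$, and $\operatorname{th}_{R}(G)=\min_{B\subseteq V(G)}\operatorname{th}_{R}(G;B)$. *)

theory Defs
  imports "Graph_Theory.Graph_Theory" "HOL-Library.Extended_Nat"
begin

text \<open>
  A finite simple undirected graph is a symmetric digraph without loops and parallel arcs
  (locale \<^locale>\<open>graph\<close>); \<open>u \<rightarrow>\<^bsub>G\<^esub> v\<close> is adjacency.
\<close>

section \<open>Concrete graphs\<close>

definition complete_graph :: "nat \<Rightarrow> nat pair_pre_digraph" where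
  "complete_graph n =
    \<lparr> pverts = {1..n}, parcs = {(u, v). u \<in> {1..n} \<and> v \<in> {1..n} \<and> u \<noteq> v} \<rparr>"

definition path_graph :: "nat \<Rightarrow> nat pair_pre_digraph" where
  "path_graph n =
    \<lparr> pverts = {1..n},
      parcs = {(u, v). u \<in> {1..n} \<and> v \<in> {1..n} \<and> (v = Suc u \<or> u = Suc v)} \<rparr>"

definition disjoint_union ::
    "'a pair_pre_digraph \<Rightarrow> 'b pair_pre_digraph \<Rightarrow> ('a + 'b) pair_pre_digraph" where
  "disjoint_union G H =
    \<lparr> pverts = pverts G <+> pverts H,
      parcs = map_prod Inl Inl ` parcs G \<union> map_prod Inr Inr ` parcs H \<rparr>"

definition copies :: "nat \<Rightarrow> 'a pair_pre_digraph \<Rightarrow> (nat \<times> 'a) pair_pre_digraph" where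
  "copies m G =
    \<lparr> pverts = {1..m} \<times> pverts G,
      parcs = {((i, u), (j, v)). i \<in> {1..m} \<and> j = i \<and> (u, v) \<in> parcs G} \<rparr>"

lemma complete_digraph_complete_graph:
  "complete_digraph n (with_proj (complete_graph n))"
  unfolding complete_digraph_pair_def by (auto simp: complete_graph_def)

lemma pair_graph_path_graph: "pair_graph (path_graph n)"
proof unfold_locales
  show "finite (parcs (path_graph n))"
    by (rule finite_subset[of _ "{1..n} \<times> {1..n}"]) (auto simp: path_graph_def)
qed (auto simp: path_graph_def symmetric_def sym_def)

lemma pair_graph_disjoint_union:
  assumes "pair_graph G" "pair_graph H"
  shows "pair_graph (disjoint_union G H)"
proof -
  interpret G: pair_graph G by fact
  interpret H: pair_graph H by fact
  show ?thesis
  proof unfold_locales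
    show "symmetric (with_proj (disjoint_union G H))"
      using G.arcs_symmetric H.arcs_symmetric
      by (force simp: disjoint_union_def symmetric_def sym_def)
  qed (auto simp: disjoint_union_def G.pair_finite_verts H.pair_finite_verts
        G.pair_finite_arcs H.pair_finite_arcs
        dest: G.wellformed' H.wellformed' G.pair_no_loops H.pair_no_loops)
qed

lemma pair_graph_copies:
  assumes "pair_graph G"
  shows "pair_graph (copies m G)"
proof -
  interpret G: pair_graph G by fact
  show ?thesis
  proof unfold_locales
    show "finite (parcs (copies m G))"
      by (rule finite_subset[of _ "({1..m} \<times> pverts G) \<times> ({1..m} \<times> pverts G)"])
        (auto simp: copies_def G.pair_finite_verts dest: G.wellformed')
    show "symmetric (with_proj (copies m G))"
      using G.arcs_symmetric by (auto simp: copies_def symmetric_def sym_def)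
  qed (auto simp: copies_def G.pair_finite_verts dest: G.wellformed' G.pair_no_loops)
qed

section \<open>Color change rules\<close>

datatype color_change_rule = Z_rule | floor_Z_rule

text \<open>
  \<open>U\<close> is the set of blue vertices and \<open>D\<close> the set of vertices that have already performed a
  force, so the active vertices are those in \<open>U - D\<close>.
\<close>

definition Z_force :: "('a, 'b) pre_digraph \<Rightarrow> 'a set \<Rightarrow> 'a \<Rightarrow> 'a \<Rightarrow> bool" where
  "Z_force G U v w \<longleftrightarrow>
    v \<in> U \<and> w \<in> verts G - U \<and> {x \<in> verts G - U. v \<rightarrow>\<^bsub>G\<^esub> x} = {w}"

definition hop :: "('a, 'b) pre_digraph \<Rightarrow> 'a set \<Rightarrow> 'a set \<Rightarrow> 'a \<Rightarrow> 'a \<Rightarrow> bool" where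
  "hop G U D v w \<longleftrightarrow>
    v \<in> U - D \<and> w \<in> verts G - U \<and> (\<forall>x. v \<rightarrow>\<^bsub>G\<^esub> x \<longrightarrow> x \<in> U)"

fun can_force ::
    "color_change_rule \<Rightarrow> ('a, 'b) pre_digraph \<Rightarrow> 'a set \<Rightarrow> 'a set \<Rightarrow> 'a \<Rightarrow> 'a \<Rightarrow> bool" where
  "can_force Z_rule G U D v w \<longleftrightarrow> Z_force G U v w"
| "can_force floor_Z_rule G U D v w \<longleftrightarrow> Z_force G U v w \<or> hop G U D v w"

text \<open>
  Forces \<open>v \<rightarrow> w\<close> are pairs \<open>(v, w)\<close>. After performing the forces in \<open>F\<close> starting from \<open>B\<close>, the
  blue vertices are \<open>B \<union> Range F\<close>, and \<open>Domain F\<close> are the vertices that have performed a force.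
\<close>

inductive forces_from ::
    "color_change_rule \<Rightarrow> ('a, 'b) pre_digraph \<Rightarrow> 'a set \<Rightarrow> ('a \<times> 'a) set \<Rightarrow> bool"
  for R G B where
  start: "forces_from R G B {}"
| force: "forces_from R G B F \<Longrightarrow> can_force R G (B \<union> Range F) (Domain F) v w
    \<Longrightarrow> forces_from R G B (insert (v, w) F)"

definition set_of_forces ::
    "color_change_rule \<Rightarrow> ('a, 'b) pre_digraph \<Rightarrow> 'a set \<Rightarrow> ('a \<times> 'a) set \<Rightarrow> bool" where
  "set_of_forces R G B F \<longleftrightarrow> forces_from R G B F \<and>
    (\<nexists>v w. can_force R G (B \<union> Range F) (Domain F) v w)"

section \<open>Propagation time and throttling\<close>

text \<open>
  \<open>forced_at R G B F t\<close> is $\mathcal F^{(t)}$. When exactly the vertices in \<open>U\<close> are blue, the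
  vertices that have performed their force in \<open>F\<close> are those in \<open>F\<inverse> `` U\<close>.
\<close>

fun forced_at :: "color_change_rule \<Rightarrow> ('a, 'b) pre_digraph \<Rightarrow> 'a set \<Rightarrow> ('a \<times> 'a) set
    \<Rightarrow> nat \<Rightarrow> 'a set" where
  "forced_at R G B F 0 = B"
| "forced_at R G B F (Suc t) =
    (let U = (\<Union>i\<in>{..t}. forced_at R G B F i)
     in {w. \<exists>v. (v, w) \<in> F \<and> can_force R G U (F\<inverse> `` U) v w})"

text \<open>
  The infima below are minima, with the convention that the infimum of the empty set is \<open>\<infinity>\<close>:
  this covers the case where \<open>F\<close> does not color all vertices blue.
\<close>

definition pt_forces :: "color_change_rule \<Rightarrow> ('a, 'b) pre_digraph \<Rightarrow> 'a set
    \<Rightarrow> ('a \<times> 'a) set \<Rightarrow> enat" where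
  "pt_forces R G B F = Inf {enat t | t. verts G = (\<Union>i\<in>{..t}. forced_at R G B F i)}"

definition pt :: "color_change_rule \<Rightarrow> ('a, 'b) pre_digraph \<Rightarrow> 'a set \<Rightarrow> enat" where
  "pt R G B = (INF F\<in>{F. set_of_forces R G B F}. pt_forces R G B F)"

definition th_of :: "color_change_rule \<Rightarrow> ('a, 'b) pre_digraph \<Rightarrow> 'a set \<Rightarrow> enat" where
  "th_of R G B = enat (card B) + pt R G B"

definition th :: "color_change_rule \<Rightarrow> ('a, 'b) pre_digraph \<Rightarrow> enat" where
  "th R G = (INF B\<in>Pow (verts G). th_of R G B)"

end

theory Submission
  imports Defs
begin

text \<open>
  Under the floor rule, too, a vertex performs at most one force, because afterwards all its
  neighbors are blue. Hence \<open>card B\<close> blue vertices color at most \<open>card B * (k + 1)\<close> vertices in \<open>k\<close>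
  steps. If \<open>card B + k \<le> 3\<close>, then either \<open>G\<close> has at most \<open>card B + k\<close> vertices, and coloring all
  of them blue does as well under the standard rule, or \<open>card B = 2\<close>, \<open>k = 1\<close> and \<open>G\<close> has four
  vertices. In the latter case, if a hop occurs, then \<open>G\<close> is a subgraph of a path on four vertices,
  and inspection leaves only \<open>2K\<^sub>2\<close> and \<open>P\<^sub>4\<close> besides the three exceptions.
\<close>

section \<open>Throttling numbers as bounds\<close>

text \<open>In \<open>enat\<close> a bound by a finite s is a strict bound by its successor, and an
  infimum lies strictly below a value iff some element does.\<close>

lemma Inf_le_enat_iff: "Inf A \<le> enat s \<longleftrightarrow> (\<exists>x\<in>A. x \<le> enat s)"
proof -
  have *: "x \<le> enat s \<longleftrightarrow> x < enat (Suc s)" for x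
    by (cases x) auto
  show ?thesis
    unfolding * by (simp add: Inf_less_iff)
qed

lemma can_force_cases:
  assumes "can_force R G U D v w"
  obtains "Z_force G U v w" | "hop G U D v w"
  using assms by (cases R) auto

lemma can_force_white:
  assumes "can_force R G U D v w"
  shows "v \<in> U" "w \<in> verts G - U"
  using assms by (auto elim!: can_force_cases simp: Z_force_def hop_def)

lemma pt_le_iff:
  "pt R G B \<le> enat m \<longleftrightarrow>
    (\<exists>F k. set_of_forces R G B F \<and> verts G = (\<Union>i\<in>{..k}. forced_at R G B F i) \<and> k \<le> m)"
proof -
  have "pt_forces R G B F \<le> enat m \<longleftrightarrow>
      (\<exists>k. verts G = (\<Union>i\<in>{..k}. forced_at R G B F i) \<and> k \<le> m)" for F
    unfolding pt_forces_def Inf_le_enat_iff Bex_def mem_Collect_eq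
    by (metis enat_ord_simps(1))
  then show ?thesis
    unfolding pt_def by (simp add: Inf_le_enat_iff)
qed

text \<open>Turns the nested infima into a search for B, F and k, so that infinite values need no
  further attention.\<close>

lemma th_le_iff:
  "th R G \<le> enat s \<longleftrightarrow>
    (\<exists>B F k. B \<subseteq> verts G \<and> set_of_forces R G B F \<and>
      verts G = (\<Union>i\<in>{..k}. forced_at R G B F i) \<and> card B + k \<le> s)"
proof -
  have "th_of R G B \<le> enat s \<longleftrightarrow> card B \<le> s \<and> pt R G B \<le> enat (s - card B)" for B
    unfolding th_of_def by (cases "pt R G B") auto
  then have "th R G \<le> enat s \<longleftrightarrow>
      (\<exists>B\<in>Pow (verts G). card B \<le> s \<and> pt R G B \<le> enat (s - card B))"
    unfolding th_def by (simp add: Inf_le_enat_iff)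
  also have "\<dots> \<longleftrightarrow> (\<exists>B F k. B \<subseteq> verts G \<and> set_of_forces R G B F \<and>
      verts G = (\<Union>i\<in>{..k}. forced_at R G B F i) \<and> card B + k \<le> s)"
    unfolding pt_le_iff by (simp add: Bex_def le_diff_conv2) (metis add.commute add_leD1 le_diff_conv2)
  finally show ?thesis .
qed

lemma th_leE:
  assumes "th R G \<le> enat s"
  obtains B F k where "B \<subseteq> verts G" "forces_from R G B F"
    "verts G = (\<Union>i\<in>{..k}. forced_at R G B F i)" "card B + k \<le> s"
  using assms unfolding th_le_iff set_of_forces_def by (elim exE conjE) (rule that)

text \<open>A force needs a white target, so maximality is automatic once every vertex is
  blue.\<close>

lemma set_of_forces_if_all_blue:
  assumes "forces_from R G B F" "verts G \<subseteq> B \<union> Range F"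
  shows "set_of_forces R G B F"
proof -
  have "\<not> can_force R G (B \<union> Range F) (Domain F) v w" for v w
    using assms(2) by (blast dest: can_force_white(2))
  then show ?thesis
    using assms(1) by (simp add: set_of_forces_def)
qed

lemma th_le_card_verts: "th R G \<le> enat (card (verts G))"
proof -
  have "set_of_forces R G (verts G) {}"
    by (rule set_of_forces_if_all_blue) (auto intro: forces_from.start)
  then show ?thesis
    unfolding th_le_iff by (intro exI[of _ "verts G"] exI[of _ "{}"] exI[of _ 0]) auto
qed

lemma forced_at_subset: "(\<Union>i\<in>{..k}. forced_at R G B F i) \<subseteq> B \<union> Range F"
proof
  fix x assume "x \<in> (\<Union>i\<in>{..k}. forced_at R G B F i)"
  then obtain i where "x \<in> forced_at R G B F i" by auto
  then show "x \<in> B \<union> Range F" by (cases i) (auto simp: Let_def)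
qed

section \<open>Comparison of the two rules\<close>

lemma forces_from_floor_Z:
  assumes "forces_from Z_rule G B F"
  shows "forces_from floor_Z_rule G B F"
  using assms by induction (auto intro: forces_from.intros)

lemma Z_forces_adjacent:
  assumes "forces_from Z_rule G B F" "(v, w) \<in> F"
  shows "v \<rightarrow>\<^bsub>G\<^esub> w"
  using assms by induction (auto simp: Z_force_def)

text \<open>The pairs in F are edges, whereas the target of a hop is white and hence not a neighbor
  of the hopping vertex. So no pair in F can ever act as a hop.\<close>

lemma forced_at_floor_Z:
  assumes "forces_from Z_rule G B F"
  shows "forced_at floor_Z_rule G B F t = forced_at Z_rule G B F t"
proof (induction t rule: less_induct)
  case (less t)
  show ?case
  proof (cases t)
    case (Suc k)
    have U: "(\<Union>i\<in>{..k}. forced_at floor_Z_rule G B F i) = (\<Union>i\<in>{..k}. forced_at Z_rule G B F i)"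
      using less Suc by auto
    have "\<not> hop G U D v w" if "(v, w) \<in> F" for U D v w
      using Z_forces_adjacent[OF assms that] by (auto simp: hop_def)
    then show ?thesis
      unfolding Suc forced_at.simps U by (auto simp: Let_def)
  qed simp
qed

lemma th_floor_Z_le: "th floor_Z_rule G \<le> th Z_rule G"
proof (cases "th Z_rule G")
  case (enat s)
  then have "th Z_rule G \<le> enat s" by simp
  then obtain B F k where *: "B \<subseteq> verts G" "forces_from Z_rule G B F"
      "verts G = (\<Union>i\<in>{..k}. forced_at Z_rule G B F i)" "card B + k \<le> s"
    by (rule th_leE)
  \<comment> \<open>Maximality under the standard rule would not exclude further hops; here they are
    excluded because nothing is left white.\<close>
  have "verts G \<subseteq> B \<union> Range F"
    using *(3) forced_at_subset by metis
  then have "set_of_forces floor_Z_rule G B F"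
    by (rule set_of_forces_if_all_blue[OF forces_from_floor_Z[OF *(2)]])
  moreover have "verts G = (\<Union>i\<in>{..k}. forced_at floor_Z_rule G B F i)"
    using *(3) by (simp add: forced_at_floor_Z[OF *(2)])
  ultimately have "th floor_Z_rule G \<le> enat s"
    unfolding th_le_iff using *(1,4) by (intro exI[of _ B] exI[of _ F] exI[of _ k] conjI)
  with enat show ?thesis by simp
qed simp

section \<open>How many vertices can be colored\<close>

text \<open>When a vertex forces, its only white neighbor turns blue, or, for a hop, it has none;
  blue vertices stay blue.\<close>

lemma forces_from_neighbors_blue:
  assumes "wf_digraph G" "forces_from R G B F" "v \<in> Domain F" "v \<rightarrow>\<^bsub>G\<^esub> x"
  shows "x \<in> B \<union> Range F"
  using assms(2,3)
proof induction
  case (force F u w)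
  have x: "x \<in> verts G"
    using assms(1,4) by (rule wf_digraph.adj_in_verts)
  from force.hyps(2) show ?case
  proof (cases rule: can_force_cases)
    case 1
    then have "\<forall>y. u \<rightarrow>\<^bsub>G\<^esub> y \<longrightarrow> y \<in> verts G \<longrightarrow> y \<in> B \<union> Range F \<or> y = w"
      by (auto simp: Z_force_def)
    with force.IH force.prems x assms(4) show ?thesis by auto
  next
    case 2
    with force.IH force.prems assms(4) show ?thesis
      by (auto simp: hop_def)
  qed
qed simp

text \<open>A second force by the same vertex cannot be a hop, which needs an active vertex, nor a
  standard force, which needs a white neighbor.\<close>

lemma forces_from_single_valued:
  assumes "wf_digraph G" "forces_from R G B F"
  shows "single_valued F"
  using assms(2)
proof induction
  case (force F v w)
  have "v \<notin> Domain F"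
  proof
    assume v: "v \<in> Domain F"
    then have "Z_force G (B \<union> Range F) v w"
      using force.hyps(2) by (auto elim!: can_force_cases simp: hop_def)
    then have "v \<rightarrow>\<^bsub>G\<^esub> w" "w \<notin> B \<union> Range F"
      by (auto simp: Z_force_def)
    then show False
      using forces_from_neighbors_blue[OF assms(1) force.hyps(1) v] by blast
  qed
  with force.IH show ?case
    by (auto simp: single_valued_def)
qed simp

lemma card_Image_le_if_single_valued:
  assumes "single_valued F" "finite A"
  shows "finite (F `` A)" "card (F `` A) \<le> card A"
proof -
  have sub: "F `` A \<subseteq> (\<lambda>v. THE w. (v, w) \<in> F) ` A"
  proof
    fix w assume "w \<in> F `` A"
    then obtain v where v: "v \<in> A" "(v, w) \<in> F" by blast
    then have "w = (THE w. (v, w) \<in> F)"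
      using assms(1) by (intro the_equality[symmetric]) (auto dest: single_valuedD)
    then show "w \<in> (\<lambda>v. THE w. (v, w) \<in> F) ` A"
      using v(1) by (rule image_eqI)
  qed
  then show "finite (F `` A)"
    by (rule finite_subset) (simp add: assms(2))
  show "card (F `` A) \<le> card A"
    using assms(2) sub by (rule surj_card_le)
qed

text \<open>Each vertex forced by time k + 1 is the image under F of a vertex blue by time k, so the
  count at k + 1 is at most \<open>card B\<close> plus the count at k.\<close>

lemma card_blue_le:
  assumes "single_valued F" "finite B"
  shows "finite (\<Union>i\<in>{..k}. forced_at R G B F i) \<and>
    card (\<Union>i\<in>{..k}. forced_at R G B F i) \<le> card B * (k + 1)"
proof (induction k)
  case (Suc k)
  let ?U = "\<lambda>k. \<Union>i\<in>{..k}. forced_at R G B F i"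
  have "forced_at R G B F i \<subseteq> B \<union> F `` ?U k" if "i \<le> Suc k" for i
  proof (cases i)
    case (Suc j)
    have "forced_at R G B F i \<subseteq> F `` ?U j"
      unfolding Suc using can_force_white(1)[of R G "?U j"] by (auto simp: Let_def)
    also have "\<dots> \<subseteq> F `` ?U k"
      using that Suc by (intro Image_mono UN_mono order_refl) auto
    finally show ?thesis by blast
  qed simp
  then have sub: "?U (Suc k) \<subseteq> B \<union> F `` ?U k"
    by blast
  note img = card_Image_le_if_single_valued[OF assms(1), of "?U k"]
  have fin: "finite (B \<union> F `` ?U k)"
    using img Suc assms(2) by blast
  have "card (?U (Suc k)) \<le> card (B \<union> F `` ?U k)"
    by (rule card_mono[OF fin sub])
  also have "\<dots> \<le> card B + card (F `` ?U k)"
    by (rule card_Un_le)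
  also have "\<dots> \<le> card B * (Suc k + 1)"
    using img Suc by simp
  finally show ?case
    using finite_subset[OF sub fin] by blast
qed (use assms in simp)

section \<open>Four vertices\<close>

text \<open>Without parallel arcs an arc is determined by its ends, so it can be renamed to the pair
  of their images. Isomorphism thus reduces to comparing sets of pairs.\<close>

lemma digraph_isoI:
  assumes "nomulti_digraph G"
    and "inj_on f (verts G)" "f ` verts G = pverts H" "map_prod f f ` arcs_ends G = parcs H"
  shows "digraph_iso G (with_proj H)"
proof -
  interpret nomulti_digraph G by fact
  let ?h = "\<lparr>iso_verts = f, iso_arcs = map_prod f f \<circ> arc_to_ends G, iso_head = snd,
    iso_tail = fst\<rparr>"
  have "arc_to_ends G ` arcs G \<subseteq> verts G \<times> verts G"
    by (auto simp: arc_to_ends_def)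
  then have "inj_on (map_prod f f \<circ> arc_to_ends G) (arcs G)"
    using assms(2) by (intro comp_inj_on inj_on_arc_to_ends)
      (auto intro: inj_on_subset[OF map_prod_inj_on])
  then have "digraph_isomorphism ?h"
    unfolding digraph_isomorphism_def using assms(2) wf_digraph
    by (auto simp: arc_to_ends_def)
  moreover have "with_proj H = app_iso ?h G"
    using assms(3,4) by (simp add: with_proj_def app_iso_def arcs_ends_def image_comp)
  ultimately show ?thesis
    unfolding digraph_iso_def by blast
qed

lemma digraph_iso_4K1I:
  assumes "nomulti_digraph G" "verts G = {a, b, c, d}" "distinct [a, b, c, d]" "arcs_ends G = {}"
  shows "digraph_iso G (with_proj (copies 4 (complete_graph 1)))"
proof (rule digraph_isoI[OF assms(1)])
  let ?f = "\<lambda>x. (if x = a then 1 else if x = b then 2 else if x = c then 3 else 4 :: nat, 1 :: nat)"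
  show "inj_on ?f (verts G)"
    using assms(2,3) by (auto simp: inj_on_def)
  have "{1..4 :: nat} = {1, 2, 3, 4}" by auto
  then show "?f ` verts G = pverts (copies 4 (complete_graph 1))"
    using assms(2,3) by (auto simp: copies_def complete_graph_def)
  show "map_prod ?f ?f ` arcs_ends G = parcs (copies 4 (complete_graph 1))"
    using assms(4) by (auto simp: copies_def complete_graph_def)
qed

lemma digraph_iso_K2_2K1I:
  assumes "nomulti_digraph G" "verts G = {a, b, c, d}" "distinct [a, b, c, d]"
    and "arcs_ends G = {(a, b), (b, a)}"
  shows "digraph_iso G
    (with_proj (disjoint_union (complete_graph 2) (copies 2 (complete_graph 1))))"
proof (rule digraph_isoI[OF assms(1)])
  let ?H = "disjoint_union (complete_graph 2) (copies 2 (complete_graph 1))"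
  let ?f = "\<lambda>x. if x = a then Inl 1 else if x = b then Inl 2
    else if x = c then Inr (1, 1) else Inr (2, 1) :: nat + nat \<times> nat"
  have two: "{1..2 :: nat} = {1, 2}" by auto
  show "inj_on ?f (verts G)"
    using assms(2,3) by (auto simp: inj_on_def)
  show "?f ` verts G = pverts ?H"
    using assms(2,3) by (auto simp: disjoint_union_def copies_def complete_graph_def two)
  have "parcs (complete_graph 2) = {(1, 2), (2, 1)}" "parcs (copies 2 (complete_graph 1)) = {}"
    by (auto simp: copies_def complete_graph_def)
  then show "map_prod ?f ?f ` arcs_ends G = parcs ?H"
    using assms(3,4) by (auto simp: disjoint_union_def)
qed

lemma digraph_iso_K1_P3I:
  assumes "nomulti_digraph G" "verts G = {a, b, c, d}" "distinct [a, b, c, d]"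
    and "arcs_ends G = {(b, c), (c, b), (c, d), (d, c)}"
  shows "digraph_iso G (with_proj (disjoint_union (complete_graph 1) (path_graph 3)))"
proof (rule digraph_isoI[OF assms(1)])
  let ?H = "disjoint_union (complete_graph 1) (path_graph 3)"
  let ?f = "\<lambda>x. if x = a then Inl 1 else if x = b then Inr 1
    else if x = c then Inr 2 else Inr 3 :: nat + nat"
  have three: "{1..3 :: nat} = {1, 2, 3}" by auto
  show "inj_on ?f (verts G)"
    using assms(2,3) by (auto simp: inj_on_def)
  show "?f ` verts G = pverts ?H"
    using assms(2,3) by (auto simp: disjoint_union_def complete_graph_def path_graph_def three)
  have "parcs (path_graph 3) = {(1, 2), (2, 1), (2, 3), (3, 2)}" "parcs (complete_graph 1) = {}"
    by (auto simp: path_graph_def complete_graph_def)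
  then show "map_prod ?f ?f ` arcs_ends G = parcs ?H"
    using assms(3,4) by (auto simp: disjoint_union_def)
qed

text \<open>With a and b blue, a forces c and b forces d in the same step, at cost 2 + 1.\<close>

lemma th_Z_le_3:
  assumes "verts G = {a, b, c, d}" "distinct [a, b, c, d]"
    and "a \<rightarrow>\<^bsub>G\<^esub> c" "\<not> a \<rightarrow>\<^bsub>G\<^esub> d" "b \<rightarrow>\<^bsub>G\<^esub> d" "\<not> b \<rightarrow>\<^bsub>G\<^esub> c"
  shows "th Z_rule G \<le> enat 3"
proof -
  \<comment> \<open>Propagation tests both forces against the initial coloring;
    \<open>forces_from\<close> adds them one at a time, so fact 3 has c already blue.\<close>
  have 1: "can_force Z_rule G {a, b} D a c" for D
    using assms by (auto simp: Z_force_def)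
  have 2: "can_force Z_rule G {a, b} D b d" for D
    using assms by (auto simp: Z_force_def)
  have 3: "can_force Z_rule G ({a, b} \<union> Range {(a, c)}) (Domain {(a, c)}) b d"
    using assms by (auto simp: Z_force_def)
  have "forces_from Z_rule G {a, b} {(a, c)}"
    by (rule forces_from.force[OF forces_from.start]) (simp add: 1 del: can_force.simps)
  then have "forces_from Z_rule G {a, b} {(b, d), (a, c)}"
    using 3 by (rule forces_from.force)
  then have "set_of_forces Z_rule G {a, b} {(b, d), (a, c)}"
    by (rule set_of_forces_if_all_blue) (use assms(1) in auto)
  moreover have "forced_at Z_rule G {a, b} {(b, d), (a, c)} 1 = {c, d}"
    using 1 2 by (auto simp: Let_def)
  then have "verts G = (\<Union>i\<in>{..1}. forced_at Z_rule G {a, b} {(b, d), (a, c)} i)"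
    using assms(1) by (auto simp: atMost_Suc)
  moreover have "{a, b} \<subseteq> verts G" "card {a, b} + 1 \<le> 3"
    using assms(1,2) by auto
  ultimately show ?thesis
    unfolding th_le_iff by blast
qed

text \<open>Only the edges of the path a, b, d, c can occur. Of the eight edge sets, the six lacking
  ab or cd are the exceptional graphs.\<close>

lemma four_vertices_th_Z_le_3:
  assumes "graph G" "verts G = {a, b, c, d}" "distinct [a, b, c, d]"
    and non: "\<not> a \<rightarrow>\<^bsub>G\<^esub> c" "\<not> a \<rightarrow>\<^bsub>G\<^esub> d" "\<not> b \<rightarrow>\<^bsub>G\<^esub> c"
    and "\<not> digraph_iso G (with_proj (disjoint_union (complete_graph 1) (path_graph 3)))"
    and "\<not> digraph_iso G
          (with_proj (disjoint_union (complete_graph 2) (copies 2 (complete_graph 1))))"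
    and "\<not> digraph_iso G (with_proj (copies 4 (complete_graph 1)))"
  shows "th Z_rule G \<le> enat 3"
proof -
  interpret graph G by fact
  have sym: "x \<rightarrow>\<^bsub>G\<^esub> y \<longleftrightarrow> y \<rightarrow>\<^bsub>G\<^esub> x" for x y
    using arcs_ends_symmetric[OF sym_arcs] by blast
  define ab cd bd where "ab \<longleftrightarrow> a \<rightarrow>\<^bsub>G\<^esub> b" "cd \<longleftrightarrow> c \<rightarrow>\<^bsub>G\<^esub> d" "bd \<longleftrightarrow> b \<rightarrow>\<^bsub>G\<^esub> d"
  note defs = this
  have arcs: "arcs_ends G = (if ab then {(a, b), (b, a)} else {}) \<union>
    (if bd then {(b, d), (d, b)} else {}) \<union> (if cd then {(c, d), (d, c)} else {})"
    (is "_ = ?E")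
  proof (rule set_eqI, clarify)
    fix x y
    have "x \<in> {a, b, c, d} \<and> y \<in> {a, b, c, d} \<and> x \<noteq> y" if "x \<rightarrow>\<^bsub>G\<^esub> y"
      using that adj_in_verts adj_not_same assms(2) by blast
    then show "x \<rightarrow>\<^bsub>G\<^esub> y \<longleftrightarrow> (x, y) \<in> ?E"
      using non sym unfolding defs by (auto split: if_splits)
  qed
  \<comment> \<open>Argument orders for the lemmas above: the edge first for
    \<open>digraph_iso_K2_2K1I\<close>, the isolated vertex first for
    \<open>digraph_iso_K1_P3I\<close>, the initial pair first for \<open>th_Z_le_3\<close>.\<close>
  have perms: "verts G = {c, d, a, b}" "verts G = {b, d, a, c}" "verts G = {c, a, b, d}"
    "verts G = {a, b, d, c}" "verts G = {a, c, b, d}"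
    using assms(2) by auto
  have "arcs_ends G \<noteq> {}"
    "arcs_ends G \<noteq> {(a, b), (b, a)}"
    "arcs_ends G \<noteq> {(c, d), (d, c)}"
    "arcs_ends G \<noteq> {(b, d), (d, b)}"
    "arcs_ends G \<noteq> {(a, b), (b, a), (b, d), (d, b)}"
    "arcs_ends G \<noteq> {(b, d), (d, b), (d, c), (c, d)}"
    using digraph_iso_4K1I[OF nomulti_digraph assms(2)]
      digraph_iso_K2_2K1I[OF nomulti_digraph assms(2)]
      digraph_iso_K2_2K1I[OF nomulti_digraph perms(1)]
      digraph_iso_K2_2K1I[OF nomulti_digraph perms(2)]
      digraph_iso_K1_P3I[OF nomulti_digraph perms(3)]
      digraph_iso_K1_P3I[OF nomulti_digraph perms(4)]
      assms(3,7-9) by auto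
  then have "ab" "cd"
    unfolding arcs by (cases ab; cases cd; cases bd; simp add: insert_commute)+
  \<comment> \<open>The ends a, c force b, d along ab and cd, and the inner vertices b, d likewise
    force a, c, whether or not bd is an edge.\<close>
  then show ?thesis
    using th_Z_le_3[OF perms(5)] th_Z_le_3[OF perms(2)] assms(3) non sym
    unfolding defs by (cases "b \<rightarrow>\<^bsub>G\<^esub> d") auto
qed

theorem corollary5p4:
  fixes G :: "('a, 'b) pre_digraph" and t :: nat
  assumes "graph G"
    and "t \<in> {1, 2, 3}"
    and "\<not> digraph_iso G (with_proj (disjoint_union (complete_graph 1) (path_graph 3)))"
    and "\<not> digraph_iso G
          (with_proj (disjoint_union (complete_graph 2) (copies 2 (complete_graph 1))))"
    and "\<not> digraph_iso G (with_proj (copies 4 (complete_graph 1)))"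
  shows "th Z_rule G = enat t \<longleftrightarrow> th floor_Z_rule G = enat t"
proof -
  interpret graph G by fact
  \<comment> \<open>The bound s is not fixed to t, because a priori the floor number could be
    smaller than t.\<close>
  have le: "th Z_rule G \<le> enat s" if "s \<le> 3" and th: "th floor_Z_rule G \<le> enat s" for s
  proof (cases "card (verts G) \<le> s")
    case True
    then show ?thesis
      using th_le_card_verts[of Z_rule G] by (meson enat_ord_simps(1) order_trans)
  next
    case False
    obtain B F k where *: "B \<subseteq> verts G" "forces_from floor_Z_rule G B F"
      "verts G = (\<Union>i\<in>{..k}. forced_at floor_Z_rule G B F i)" "card B + k \<le> s"
      using th by (rule th_leE)
    have sv: "single_valued F"
      using wf_digraph *(2) by (rule forces_from_single_valued)
    have fin: "finite B"
      using *(1) finite_verts by (rule finite_subset)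
    have card: "card (verts G) \<le> card B * (k + 1)"
      using card_blue_le[OF sv fin] *(3) by metis
    have "k \<in> {0, 1, 2, 3}" "card B \<in> {0, 1, 2, 3}"
      using *(4) \<open>s \<le> 3\<close> by auto
    \<comment> \<open>From \<open>card B + k\<close> at most s and s below
      \<open>card B * (k + 1)\<close> follows k < \<open>card B * k\<close>, so k is at least 1 and
      \<open>card B\<close> at least 2; their sum is at most 3.\<close>
    then have k: "k = 1" "card B = 2" "s = 3" "card (verts G) = 4"
      using card *(4) \<open>s \<le> 3\<close> False by auto
    let ?D = "F\<inverse> `` B"
    have V: "verts G = B \<union> {w. \<exists>v. (v, w) \<in> F \<and> can_force floor_Z_rule G B ?D v w}"
      using *(3) k(1) by (simp add: atMost_Suc Let_def Un_commute)
    have "card (verts G - B) = 2"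
      using card_Diff_subset[OF fin *(1)] k(2,4) by simp
    then obtain c d where cd: "verts G - B = {c, d}" "c \<noteq> d"
      unfolding card_2_iff by (elim exE conjE)
    have forced: "\<exists>v. (v, w) \<in> F \<and> can_force floor_Z_rule G B ?D v w"
      if "w \<in> verts G - B" for w
      using that V by blast
    obtain a where ac: "(a, c) \<in> F" "can_force floor_Z_rule G B ?D a c"
      using forced[of c] cd(1) by blast
    obtain b where bd: "(b, d) \<in> F" "can_force floor_Z_rule G B ?D b d"
      using forced[of d] cd(1) by blast
    \<comment> \<open>No vertex forces twice, so the two forcing vertices are distinct and exhaust
      B.\<close>
    have "a \<noteq> b"
      using sv ac(1) bd(1) cd(2) by (auto simp: single_valued_def)
    moreover have "a \<in> B" "b \<in> B"
      using can_force_white(1)[OF ac(2)] can_force_white(1)[OF bd(2)] by auto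
    ultimately have B: "B = {a, b}"
      using k(2) by (auto simp: card_2_iff)
    have verts: "verts G = {a, b, c, d}" "verts G = {b, a, d, c}"
      using cd(1) *(1) B by auto
    have "c \<notin> B" "d \<notin> B"
      using cd(1) by auto
    then have dist: "distinct [a, b, c, d]" "distinct [b, a, d, c]"
      using B cd(2) \<open>a \<noteq> b\<close> by auto
    have Z: "v \<rightarrow>\<^bsub>G\<^esub> w \<and> \<not> v \<rightarrow>\<^bsub>G\<^esub> w'"
      if "Z_force G B v w" "w' \<in> verts G - B" "w' \<noteq> w" for v w w'
      using that by (auto simp: Z_force_def)
    have hop: "\<not> v \<rightarrow>\<^bsub>G\<^esub> c \<and> \<not> v \<rightarrow>\<^bsub>G\<^esub> d" if "hop G B ?D v w" for v w
      using that \<open>c \<notin> B\<close> \<open>d \<notin> B\<close> by (auto simp: hop_def)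
    \<comment> \<open>The left alternative is a standard force, the right one a hop.\<close>
    have a: "a \<rightarrow>\<^bsub>G\<^esub> c \<and> \<not> a \<rightarrow>\<^bsub>G\<^esub> d \<or> \<not> a \<rightarrow>\<^bsub>G\<^esub> c \<and> \<not> a \<rightarrow>\<^bsub>G\<^esub> d"
      using ac(2) Z[of a c d] hop[of a] cd by auto
    have b: "b \<rightarrow>\<^bsub>G\<^esub> d \<and> \<not> b \<rightarrow>\<^bsub>G\<^esub> c \<or> \<not> b \<rightarrow>\<^bsub>G\<^esub> c \<and> \<not> b \<rightarrow>\<^bsub>G\<^esub> d"
      using bd(2) Z[of b d c] hop[of b] cd by auto
    \<comment> \<open>Two standard forces give \<open>th_Z_le_3\<close>. If a hops, the missing
      edges ac, ad and bc give the path case; if b hops, the same holds with a, b and c, d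
      swapped.\<close>
    show ?thesis
      unfolding k(3)
      using a b th_Z_le_3[OF verts(1) dist(1)]
        four_vertices_th_Z_le_3[OF assms(1) verts(1) dist(1) _ _ _ assms(3-5)]
        four_vertices_th_Z_le_3[OF assms(1) verts(2) dist(2) _ _ _ assms(3-5)]
      by blast
  qed
  show ?thesis
  proof
    assume "th floor_Z_rule G = enat t"
    then show "th Z_rule G = enat t"
      using le[of t] th_floor_Z_le[of G] assms(2) by auto
  next
    assume Z: "th Z_rule G = enat t"
    then obtain s where s: "th floor_Z_rule G = enat s" "s \<le> t"
      using th_floor_Z_le[of G] by (cases "th floor_Z_rule G") auto
    then show "th floor_Z_rule G = enat t"
      using le[of s] Z assms(2) by auto
  qed
qed

end
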